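(* Let $R$ be a commutative associative ring with unit, let $a,b\in R$ with $a\neq b$, and let $n,k$ be integers with $1\le k\le n$. Let $A=(a_{ij})_{1\le i,j\le n}$ be the $n\times n$ matrix over $R$ with $a_{ij}=b$ if $0\le j-i<k$ and $a_{ij}=a$ otherwise. Let $p$ be the integer with $n\equiv p\pmod{k}$ and $0<p\le k$. Then $$\det A=(b-a)^{n-1}\left(b+\frac{n-p}{k}\,a\right).$$
   Context: The number $\frac{n-p}{k}$ is a non-negative integer, and $\frac{n-p}{k}\,a$ denotes the corresponding integer multiple of $a$ in $R$. The convention $x^0=1$ is used for $x \in R$. *)

theory Defs
  imports "Jordan_Normal_Form.Determinant" "HOL-Number_Theory.Cong"
begin

text \<open>Matrix indices run from 0 to n - 1 here; the defining condition depends only on j - i,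
  so the shift from indices 1, ..., n does not affect it. The difference is taken in the integers.\<close>

definition band_mat :: "nat \<Rightarrow> nat \<Rightarrow> 'a \<Rightarrow> 'a \<Rightarrow> 'a mat" where
  "band_mat n k a b =
     mat n n (\<lambda>(i, j). if 0 \<le> int j - int i \<and> int j - int i < int k then b else a)"

end

theory Submission
  imports Defs
begin

text \<open>Subtracting from each row of the band matrix the next one leaves
  \<open>(b - a) (e\<^sub>i - e\<^bsub>i+k\<^esub>)\<close> in every row \<open>i\<close> but the last (with \<open>e\<^bsub>i+k\<^esub> = 0\<close>
  when \<open>i + k \<ge> n\<close>), while the last row is \<open>(a, \<dots>, a, b)\<close>.  With \<open>N\<close> the matrix that has
  ones directly above the diagonal and zeros elsewhere, the first \<open>n - 1\<close> rows are thus those of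
  \<open>(b - a) (1 - N\<^sup>k)\<close>, and
  \<open>1 - N\<^sup>k\<close> has the inverse \<open>1 + N\<^sup>k + N\<^sup>2\<^sup>k + \<dots>\<close>.  Multiplying by this inverse on the right
  yields a lower triangular matrix: its first \<open>n - 1\<close> diagonal entries are \<open>b - a\<close>, and the last one
  is \<open>b\<close> plus one summand \<open>a\<close> for each \<open>m < n - 1\<close> congruent to \<open>n - 1\<close> modulo \<open>k\<close>
  (lemma \<open>diff_band_step\<close>).  There are \<open>(n - 1) div k = (n - p) div k\<close> such \<open>m\<close>.  Both multipliers are
  unitriangular, so the determinant is unchanged; no division takes place, and the argument is valid
  over any commutative ring.\<close>

text \<open>The matrix \<open>1 - N\<close>, where \<open>N\<close> has ones directly above the diagonal and zeros elsewhere;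
  multiplication by it on the left subtracts from each row the next one.\<close>

definition diff_mat :: "nat \<Rightarrow> 'a :: comm_ring_1 mat" where
  "diff_mat n = mat n n (\<lambda>(i, j). of_bool (j = i) - of_bool (j = Suc i))"

text \<open>The matrix \<open>1 + N\<^sup>k + N\<^sup>2\<^sup>k + \<dots>\<close>, the inverse of \<open>1 - N\<^sup>k\<close> for \<open>k > 0\<close>.\<close>

definition step_mat :: "nat \<Rightarrow> nat \<Rightarrow> 'a :: comm_ring_1 mat" where
  "step_mat n k = mat n n (\<lambda>(i, j). of_bool (i \<le> j \<and> k dvd j - i))"

lemma det_upper_unitriangular:
  fixes A :: "'a :: comm_ring_1 mat"
  assumes A: "A \<in> carrier_mat n n"
    and low: "\<And>i j. j < i \<Longrightarrow> i < n \<Longrightarrow> A $$ (i, j) = 0"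
    and diag: "\<And>i. i < n \<Longrightarrow> A $$ (i, i) = 1"
  shows "det A = 1"
proof -
  have "upper_triangular A"
    using A low by (auto simp: upper_triangular_def)
  then have "det A = prod_list (diag_mat A)"
    using A by (rule det_upper_triangular)
  also have "\<dots> = (\<Prod>i = 0..<n. A $$ (i, i))"
    using A by (simp add: prod_list_diag_prod)
  also have "\<dots> = 1"
    using diag by simp
  finally show ?thesis .
qed

lemma det_diff_mat: "det (diff_mat n :: 'a :: comm_ring_1 mat) = 1"
  by (rule det_upper_unitriangular[of _ n]) (auto simp: diff_mat_def)

lemma det_step_mat: "det (step_mat n k :: 'a :: comm_ring_1 mat) = 1"
  by (rule det_upper_unitriangular[of _ n]) (auto simp: step_mat_def)

lemma sum_diff_of_bool_mult:
  fixes f :: "nat \<Rightarrow> 'a :: comm_ring_1"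
  assumes "i < n"
  shows "(\<Sum>m = 0..<n. (of_bool (m = i) - of_bool (m = l)) * f m)
    = f i - (if l < n then f l else 0)"
proof -
  have "(\<Sum>m = 0..<n. (of_bool (m = i) - of_bool (m = l)) * f m)
      = (\<Sum>m = 0..<n. (if m = i then f m else 0) - (if m = l then f m else 0))"
    by (intro sum.cong) auto
  then show ?thesis
    using assms by (simp add: sum_subtractf)
qed

lemma diff_band:
  assumes "0 < k" "i < n" "j < n"
  shows "(diff_mat n * band_mat n k a b :: 'a :: comm_ring_1 mat) $$ (i, j) =
    (if Suc i < n then (b - a) * (of_bool (j = i) - of_bool (j = i + k))
     else if j = i then b else a)"
proof -
  have "(diff_mat n * band_mat n k a b) $$ (i, j) =
      (\<Sum>m = 0..<n. (of_bool (m = i) - of_bool (m = Suc i)) * band_mat n k a b $$ (m, j))"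
    using assms by (simp add: diff_mat_def band_mat_def scalar_prod_def)
  also have "\<dots> = band_mat n k a b $$ (i, j)
      - (if Suc i < n then band_mat n k a b $$ (Suc i, j) else 0)"
    using assms(2) by (rule sum_diff_of_bool_mult)
  finally show ?thesis
    using assms by (auto simp: band_mat_def)
qed

lemma card_multiples_atLeastAtMost_1:
  assumes "0 < (k :: nat)"
  shows "card {m \<in> {1..N}. k dvd m} = N div k"
proof -
  have "{m \<in> {1..N}. k dvd m} = (\<lambda>q. k * q) ` {1..N div k}"
    using assms
    by (auto simp: less_eq_div_iff_mult_less_eq mult.commute elim!: dvdE)
  moreover have "inj_on (\<lambda>q. k * q) {1..N div k}"
    using assms by (auto intro: inj_onI)
  ultimately show ?thesis
    by (simp add: card_image)
qed

lemma sum_of_bool_dvd_diff: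
  assumes "0 < (k :: nat)"
  shows "(\<Sum>m = 0..<N. of_bool (k dvd N - m)) = (of_nat (N div k) :: 'a :: comm_ring_1)"
proof -
  have "(\<Sum>m = 0..<N. of_bool (k dvd N - m)) = (\<Sum>m = 1..N. of_bool (k dvd m) :: 'a)"
    by (rule sum.reindex_bij_witness[of _ "\<lambda>m. N - m" "\<lambda>m. N - m"]) auto
  also have "\<dots> = of_nat (card {m \<in> {1..N}. k dvd m})"
    by (simp add: sum_of_bool_eq Int_def)
  finally show ?thesis
    by (simp only: card_multiples_atLeastAtMost_1[OF assms])
qed

text \<open>The part of the last row left of the diagonal does not affect the determinant and is not
  described.\<close>

lemma diff_band_step:
  assumes "0 < k" "i \<le> j" "j < n"
  shows "(diff_mat n * band_mat n k a b * step_mat n k :: 'a :: comm_ring_1 mat) $$ (i, j) =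
    (if i < j then 0 else if Suc i < n then b - a else b + of_nat ((n - 1) div k) * a)"
proof -
  define B where "B = diff_mat n * band_mat n k a b"
  have B_carrier: "B \<in> carrier_mat n n"
    by (auto simp: B_def diff_mat_def band_mat_def)
  have entry: "(B * step_mat n k) $$ (i, j)
      = (\<Sum>m = 0..<n. B $$ (i, m) * of_bool (m \<le> j \<and> k dvd j - m))"
    using assms B_carrier by (simp add: step_mat_def scalar_prod_def)
  show ?thesis
  proof (cases "Suc i < n")
    case True
    have "(B * step_mat n k) $$ (i, j) = (b - a) *
        (\<Sum>m = 0..<n. (of_bool (m = i) - of_bool (m = i + k)) * of_bool (m \<le> j \<and> k dvd j - m))"
      unfolding entry sum_distrib_left using assms True
      by (intro sum.cong) (simp_all add: B_def diff_band mult.assoc)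
    also have "\<dots> = (b - a) * (of_bool (i \<le> j \<and> k dvd j - i)
        - (if i + k < n then of_bool (i + k \<le> j \<and> k dvd j - (i + k)) else 0))"
      using True by (subst sum_diff_of_bool_mult) auto
    also have "\<dots> = (if i < j then 0 else b - a)"
    proof -
      have "k dvd j - i \<longleftrightarrow> i + k \<le> j \<and> k dvd j - (i + k)" if "i < j"
      proof (cases "i + k \<le> j")
        case True
        then have "j - i = j - (i + k) + k" by simp
        then show ?thesis using True by (metis dvd_add_triv_right_iff)
      next
        case False
        then show ?thesis using that nat_dvd_not_less[of "j - i" k] by simp
      qed
      then show ?thesis using assms by auto
    qed
    finally show ?thesis using True by (simp add: B_def)
  next
    case False
    then obtain N where n: "n = Suc N" and i: "i = N" and j: "j = N"
      using assms by (cases n) auto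
    have "(B * step_mat n k) $$ (i, j)
        = (\<Sum>m = 0..<N. B $$ (N, m) * of_bool (k dvd N - m)) + B $$ (N, N)"
      unfolding entry by (simp add: n i j)
    also have "\<dots> = (\<Sum>m = 0..<N. a * of_bool (k dvd N - m)) + b"
      using assms by (simp add: B_def n diff_band)
    also have "\<dots> = b + of_nat (N div k) * a"
      using assms
      by (simp only: sum_distrib_left[symmetric] sum_of_bool_dvd_diff) (simp add: mult.commute)
    finally show ?thesis using n i j by (simp add: B_def)
  qed
qed

text \<open>The same formula with \<open>(n - 1) div k\<close> in place of \<open>(n - p) div k\<close>; here the width \<open>k\<close> may
  also exceed \<open>n\<close>.\<close>

lemma det_band_mat:
  fixes a b :: "'a :: comm_ring_1"
  assumes "0 < k" "0 < n"
  shows "det (band_mat n k a b) = (b - a) ^ (n - 1) * (b + of_nat ((n - 1) div k) * a)"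
proof -
  define L where "L = diff_mat n * band_mat n k a b * step_mat n k"
  have carrier: "diff_mat n \<in> carrier_mat n n" "band_mat n k a b \<in> carrier_mat n n"
    "step_mat n k \<in> carrier_mat n n" "L \<in> carrier_mat n n"
    by (auto simp: L_def diff_mat_def band_mat_def step_mat_def)
  have "det L = det (diff_mat n) * det (band_mat n k a b) * det (step_mat n k)"
    unfolding L_def using carrier(1-3) by (metis det_mult mult_carrier_mat)
  then have "det (band_mat n k a b) = det L"
    by (simp add: det_diff_mat det_step_mat)
  also have "\<dots> = prod_list (diag_mat L)"
    using carrier assms by (intro det_lower_triangular[of n]) (simp_all add: L_def diff_band_step)
  also have "\<dots> = (\<Prod>i = 0..<n. L $$ (i, i))"
    using carrier by (simp add: prod_list_diag_prod)
  also have "\<dots> = (\<Prod>i = 0..<n - 1. L $$ (i, i)) * L $$ (n - 1, n - 1)"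
    using assms prod.atLeast0_lessThan_Suc[of "\<lambda>i. L $$ (i, i)" "n - 1"] by simp
  also have "\<dots> = (b - a) ^ (n - 1) * (b + of_nat ((n - 1) div k) * a)"
    using assms by (simp add: L_def diff_band_step less_diff_conv cong: prod.cong_simp)
  finally show ?thesis .
qed

theorem theorem1p1:
  fixes a b :: "'a :: comm_ring_1" and n k p :: nat
  assumes "a \<noteq> b"
    and "1 \<le> k" and "k \<le> n"
    and "[n = p] (mod k)" and "0 < p" and "p \<le> k"
  shows "det (band_mat n k a b) = (b - a) ^ (n - 1) * (b + of_nat ((n - p) div k) * a)"
proof -
  have "p \<le> n" using assms by simp
  then have "k dvd n - p"
    using assms(4) by (metis cong_altdef_nat cong_sym)
  then obtain q where q: "n - p = k * q" ..
  then have n: "n - 1 = (p - 1) + k * q"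
    using \<open>p \<le> n\<close> assms by simp
  have "(n - 1) div k = q"
    unfolding n using assms by (subst div_mult_self2) simp_all
  moreover have "(n - p) div k = q"
    using q assms by simp
  ultimately show ?thesis
    using det_band_mat[of k n a b] assms by simp
qed

end
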